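(* Let $\bm{Q}\in\mathbb{R}^{p\times p}$ be symmetric positive semidefinite, $\bm{b}\in\mathbb{R}^p$, and $f(\bm{\theta})=\frac12\bm{\theta}^\top\bm{Q}\bm{\theta}+\bm{b}^\top\bm{\theta}$ on $\mathbb{R}^p$. Let $\bm{\Sigma}$ be symmetric positive definite with $\bm{\Sigma}^{-1}-\bm{Q}$ positive definite. If the normal distribution $\mathrm{N}(\bm{\theta},\bm{\Sigma})$ with unknown mean $\bm{\theta}$ and known covariance $\bm{\Sigma}$ is employed as $p_{\bm{x}}(\bm{\theta})$ in the EM algorithm for minimizing $f$ over $\mathbb{R}^p$, then the natural gradient update formula $\bm{\theta}^{(t)}=\bm{\theta}^{(t-1)}-\bm{I}_{p_{\bm{x}}}(\bm{\theta}^{(t-1)})^{-1}\nabla f(\bm{\theta}^{(t-1)})$ results in $$\bm{\theta}^{(t)}=\bm{\theta}^{(t-1)}-\bm{\Sigma}(\bm{Q}\bm{\theta}^{(t-1)}+\bm{b}).$$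
   Context: EM algorithm for minimizing $f$ over $\Theta$ (here $\Theta=\mathbb{R}^p$): given a parametric density $p_{\bm{x}}(\bm{\theta})$ and a positive function $G$ with $f(\bm{\theta})=-\ln\mathbb{E}_{p_{\bm{x}}(\bm{\theta})}[G(\bm{X})]$, iterate $\bm{\theta}^{(t)}\in\arg\min_{\bm{\theta}\in\Theta}\{-\int q_{\bm{x}}(\bm{\theta}^{(t-1)})\ln(G(\bm{x})p_{\bm{x}}(\bm{\theta}))d\bm{x}\}$, where $q_{\bm{x}}(\bm{\theta})=G(\bm{x})p_{\bm{x}}(\bm{\theta})/\mathbb{E}_{p_{\bm{x}}(\bm{\theta})}[G(\bm{X})]$; the natural gradient update formula in the claim is the one giving the stationary point of this minimization. Fisher information matrix: $\bm{I}_{p_{\bm{x}}}(\bm{\theta}):=\mathbb{E}_{p_{\bm{x}}(\bm{\theta})}[\nabla\ln p_{\bm{X}}(\bm{\theta})\nabla\ln p_{\bm{X}}(\bm{\theta})^\top]$ (gradients in $\bm{\theta}$). *)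

theory Defs
  imports "HOL-Analysis.Analysis"
begin

definition sym_pos_semidef :: "real^'n^'n \<Rightarrow> bool" where
  "sym_pos_semidef A \<longleftrightarrow> transpose A = A \<and> (\<forall>v. 0 \<le> v \<bullet> (A *v v))"

definition sym_pos_def :: "real^'n^'n \<Rightarrow> bool" where
  "sym_pos_def A \<longleftrightarrow> transpose A = A \<and> (\<forall>v. v \<noteq> 0 \<longrightarrow> 0 < v \<bullet> (A *v v))"

(* Only meaningful where f is differentiable. *)
definition gradient :: "('a::real_inner \<Rightarrow> real) \<Rightarrow> 'a \<Rightarrow> 'a" where
  "gradient f a = (THE D. GDERIV f a :> D)"

(* A parametric density is a function p with p \<theta> x the value at x of the Lebesgue density
   with parameter \<theta>. *)

definition law :: "('t \<Rightarrow> 'x::euclidean_space \<Rightarrow> real) \<Rightarrow> 't \<Rightarrow> 'x measure" where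
  "law p \<theta> = density lborel (\<lambda>x. ennreal (p \<theta> x))"

definition fisher_information ::
    "(real^'n \<Rightarrow> 'x::euclidean_space \<Rightarrow> real) \<Rightarrow> real^'n \<Rightarrow> real^'n^'n" where
  "fisher_information p \<theta> =
     (LINT x|law p \<theta>.
        (let s = gradient (\<lambda>\<eta>. ln (p \<eta> x)) \<theta> in (\<chi> i j. s $ i * s $ j)))"

definition natural_gradient_step ::
    "(real^'n \<Rightarrow> 'x::euclidean_space \<Rightarrow> real) \<Rightarrow> (real^'n \<Rightarrow> real) \<Rightarrow> real^'n \<Rightarrow> real^'n" where
  "natural_gradient_step p f \<theta> =
     \<theta> - matrix_inv (fisher_information p \<theta>) *v gradient f \<theta>"

definition em_q ::
    "('t \<Rightarrow> 'x::euclidean_space \<Rightarrow> real) \<Rightarrow> ('x \<Rightarrow> real) \<Rightarrow> 't \<Rightarrow> 'x \<Rightarrow> real" where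
  "em_q p G \<theta> x = G x * p \<theta> x / (LINT y|law p \<theta>. G y)"

(* The function of \<theta> minimised in an EM iteration started from \<theta>'. *)
definition em_objective ::
    "('t \<Rightarrow> 'x::euclidean_space \<Rightarrow> real) \<Rightarrow> ('x \<Rightarrow> real) \<Rightarrow> 't \<Rightarrow> 't \<Rightarrow> real" where
  "em_objective p G \<theta>' \<theta> = - (LINT x|lborel. em_q p G \<theta>' x * ln (G x * p \<theta> x))"

(* The two integrability conditions say that the expectation of G and the integrals in the EM
   objective exist; otherwise the Bochner integral would silently be 0. *)
definition em_setting ::
    "('t \<Rightarrow> 'x::euclidean_space \<Rightarrow> real) \<Rightarrow> ('x \<Rightarrow> real) \<Rightarrow> ('t \<Rightarrow> real) \<Rightarrow> bool" where
  "em_setting p G f \<longleftrightarrow>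
     G \<in> borel_measurable borel \<and> (\<forall>x. 0 < G x) \<and>
     (\<forall>\<theta>. integrable (law p \<theta>) G \<and> f \<theta> = - ln (LINT x|law p \<theta>. G x)) \<and>
     (\<forall>\<theta>' \<theta>. integrable lborel (\<lambda>x. em_q p G \<theta>' x * ln (G x * p \<theta> x)))"

definition em_step ::
    "('t \<Rightarrow> 'x::euclidean_space \<Rightarrow> real) \<Rightarrow> ('x \<Rightarrow> real) \<Rightarrow> 't \<Rightarrow> 't \<Rightarrow> bool" where
  "em_step p G \<theta>' \<theta> \<longleftrightarrow> is_arg_min (em_objective p G \<theta>') (\<lambda>\<eta>. \<eta> \<in> UNIV) \<theta>"

(* \<Sigma> is the covariance matrix; the mean is the parameter \<theta>. *)
definition mvn_density :: "real^'n^'n \<Rightarrow> real^'n \<Rightarrow> real^'n \<Rightarrow> real" where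
  "mvn_density \<Sigma> \<theta> x =
     exp (- ((x - \<theta>) \<bullet> (matrix_inv \<Sigma> *v (x - \<theta>))) / 2) / sqrt ((2 * pi) ^ CARD('n) * det \<Sigma>)"

end

theory Submission
  imports Defs "HOL-Probability.Distributions"
begin

text \<open>Let \<open>P\<close> be the inverse of \<open>\<Sigma>\<close>. The logarithm of the normal density is quadratic in
  \<open>\<theta>\<close> with Hessian \<open>- P\<close>, and its score \<open>P (x - \<theta>)\<close> has covariance \<open>P \<Sigma> P = P\<close>; so the
  Fisher information is \<open>P\<close>, and the natural gradient step is \<open>\<theta> - \<Sigma> \<nabla>f \<theta>\<close>. For every
  admissible \<open>G\<close> the EM objective is a quadratic function of \<open>\<theta>\<close> with Hessian \<open>P\<close>. By
  Jensen's inequality it majorises \<open>f\<close> up to a constant, with contact at the current iterate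
  \<open>\<theta>'\<close>, so its gradient at \<open>\<theta>'\<close> is \<open>\<nabla>f \<theta>'\<close>, and its only stationary point is its minimiser
  \<open>\<theta>' - \<Sigma> \<nabla>f \<theta>'\<close>. Since \<open>P - Q\<close> is positive definite, an admissible \<open>G\<close> exists: a
  quotient of two normal densities.\<close>

subsection \<open>Lebesgue measure under linear maps\<close>

lemma linear_borel_measurable:
  fixes f :: "'a::euclidean_space \<Rightarrow> 'b::euclidean_space"
  assumes "linear f" shows "f \<in> borel_measurable borel"
  using assms by (simp add: borel_measurable_continuous_onI linear_continuous_on linear_linear)

lemma matrix_vector_mult_measurable [measurable]:
  fixes A :: "real^'n^'m"
  shows "(*v) A \<in> borel_measurable borel"
  by (rule linear_borel_measurable) simp

lemma nn_integral_lborel_shift: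
  fixes f :: "'a::euclidean_space \<Rightarrow> ennreal"
  assumes [measurable]: "f \<in> borel_measurable borel"
  shows "(\<integral>\<^sup>+x. f (t + x) \<partial>lborel) = (\<integral>\<^sup>+x. f x \<partial>lborel)"
  by (subst (2) lborel_affine[of 1 t]) (simp_all add: nn_integral_density nn_integral_distr)

lemma nn_integral_lborel_reflect:
  fixes f :: "'a::euclidean_space \<Rightarrow> ennreal"
  assumes [measurable]: "f \<in> borel_measurable borel"
  shows "(\<integral>\<^sup>+x. f (t - x) \<partial>lborel) = (\<integral>\<^sup>+x. f x \<partial>lborel)"
  by (subst (2) lborel_affine[of "-1" t]) (simp_all add: nn_integral_density nn_integral_distr)

text \<open>Uniqueness of Haar measure for the image of Lebesgue measure under \<open>T\<close>: apply Tonelli to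
  \<open>f (T x) * g (y + T x)\<close>, and translate in either variable.\<close>

lemma nn_integral_linear_swap:
  fixes T :: "'a::euclidean_space \<Rightarrow> 'a" and f g :: "'a \<Rightarrow> ennreal"
  assumes lin: "linear T" and "surj T"
    and f [measurable]: "f \<in> borel_measurable borel" and g [measurable]: "g \<in> borel_measurable borel"
  shows "(\<integral>\<^sup>+x. f (T x) \<partial>lborel) * (\<integral>\<^sup>+x. g x \<partial>lborel) =
    (\<integral>\<^sup>+x. f x \<partial>lborel) * (\<integral>\<^sup>+x. g (T x) \<partial>lborel)"
proof -
  have T [measurable]: "T \<in> borel_measurable borel"
    using lin by (rule linear_borel_measurable)
  have "(\<integral>\<^sup>+x. f (T x) \<partial>lborel) * (\<integral>\<^sup>+x. g x \<partial>lborel) =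
      (\<integral>\<^sup>+x. \<integral>\<^sup>+y. f (T x) * g (T x + y) \<partial>lborel \<partial>lborel)"
    by (simp add: nn_integral_cmult nn_integral_lborel_shift nn_integral_multc)
  also have "\<dots> = (\<integral>\<^sup>+y. \<integral>\<^sup>+x. f (T x) * g (T x + y) \<partial>lborel \<partial>lborel)"
    by (rule lborel_pair.Fubini') measurable
  also have "\<dots> = (\<integral>\<^sup>+y. \<integral>\<^sup>+x. f (T x - y) * g (T x) \<partial>lborel \<partial>lborel)"
  proof (rule nn_integral_cong)
    fix y
    obtain z where z: "T z = y" using \<open>surj T\<close> by (metis surjD)
    show "(\<integral>\<^sup>+x. f (T x) * g (T x + y) \<partial>lborel) = (\<integral>\<^sup>+x. f (T x - y) * g (T x) \<partial>lborel)"
      using nn_integral_lborel_shift[of "\<lambda>x. f (T x - y) * g (T x)" z] z lin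
      by (simp add: linear_add add.commute)
  qed
  also have "\<dots> = (\<integral>\<^sup>+x. \<integral>\<^sup>+y. f (T x - y) * g (T x) \<partial>lborel \<partial>lborel)"
    by (rule lborel_pair.Fubini') measurable
  also have "\<dots> = (\<integral>\<^sup>+x. f x \<partial>lborel) * (\<integral>\<^sup>+x. g (T x) \<partial>lborel)"
    by (simp add: nn_integral_cmult nn_integral_lborel_reflect nn_integral_multc)
  finally show ?thesis .
qed

text \<open>Swapping against the indicator of the unit cube \<open>B\<close>, whose integral is 1,
  shows that composing with \<open>T\<close> multiplies every integral by one factor
  \<open>d\<close>; then \<open>c\<close> is the reciprocal of \<open>d\<close>. The factor is
  finite because \<open>T\<close> pulls the bounded set \<open>B\<close> back to a bounded
  set.\<close>

lemma nn_integral_linear_modulus: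
  fixes T :: "'a::euclidean_space \<Rightarrow> 'a"
  assumes lin: "linear T" and inj: "inj T"
  obtains c :: real where "c > 0"
    "\<And>f. f \<in> borel_measurable borel \<Longrightarrow> (\<integral>\<^sup>+x. f x \<partial>lborel) = ennreal c * (\<integral>\<^sup>+x. f (T x) \<partial>lborel)"
proof -
  have T [measurable]: "T \<in> borel_measurable borel"
    using lin by (rule linear_borel_measurable)
  have surj: "surj T" using lin inj by (rule linear_injective_imp_surjective) simp
  define h where "h = inv T"
  have hT [simp]: "h (T x) = x" and Th: "T (h x) = x" for x
    using inj surj by (simp_all add: h_def surj_f_inv_f)
  have "linear h"
    using lin inj surj by (simp add: h_def bij_def inj_linear_imp_inv_linear)
  then have h [measurable]: "h \<in> borel_measurable borel"
    by (rule linear_borel_measurable)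
  define B where "B = cbox 0 (One :: 'a)"
  have B [measurable]: "B \<in> sets borel" by (simp add: B_def)
  define d where "d = (\<integral>\<^sup>+x. indicator B (T x) \<partial>lborel)"
  have swap: "d * (\<integral>\<^sup>+x. f x \<partial>lborel) = (\<integral>\<^sup>+x. f (T x) \<partial>lborel)"
    if "f \<in> borel_measurable borel" for f
    using nn_integral_linear_swap[OF lin surj _ that, of "indicator B"]
    by (simp add: d_def B_def)
  \<comment> \<open>Composing this integrand with \<open>T\<close> yields the indicator of
    \<open>B\<close>, so \<open>d\<close> times an integral equals 1.\<close>
  have "d \<noteq> 0"
    using swap[of "\<lambda>x. indicator B (h x)"] by (auto simp: B_def)
  moreover have "d < \<infinity>"
  proof -
    have eq: "T -` B = h ` B"
      using hT Th by (metis bij_vimage_eq_inv_image bij_def h_def inj surj)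
    have "bounded (h ` B)"
      using \<open>linear h\<close> by (simp add: B_def bounded_linear_image linear_conv_bounded_linear)
    then have "emeasure lborel (T -` B) < \<infinity>"
      unfolding eq by (rule emeasure_bounded_finite)
    moreover have "T -` B \<in> sets borel"
      using measurable_sets[OF T B] by simp
    moreover have "(indicator B (T x) :: ennreal) = indicator (T -` B) x" for x
      by (simp add: indicator_def)
    ultimately show ?thesis by (simp add: d_def)
  qed
  ultimately obtain r where r: "d = ennreal r" "r > 0"
    by (cases d) (auto simp: zero_less_iff_neq_zero)
  show ?thesis
  proof
    show "1 / r > 0" using r by simp
    show "(\<integral>\<^sup>+x. f x \<partial>lborel) = ennreal (1 / r) * (\<integral>\<^sup>+x. f (T x) \<partial>lborel)"
      if "f \<in> borel_measurable borel" for f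
      using r by (simp add: swap[OF that, symmetric] mult.assoc[symmetric] flip: ennreal_mult'')
  qed
qed

text \<open>The modulus of a matrix is multiplicative and positive, as is \<open>\<bar>det\<bar>\<close>, so both are
  1 on involutions.\<close>

lemma nn_integral_matrix_involution:
  fixes A :: "real^'n^'n"
  assumes A: "A ** A = mat 1" and f: "f \<in> borel_measurable borel"
  shows "(\<integral>\<^sup>+x. f x \<partial>lborel) = ennreal \<bar>det A\<bar> * (\<integral>\<^sup>+x. f (A *v x) \<partial>lborel)"
proof -
  have "A *v (A *v x) = x" for x
    using A by (simp add: matrix_vector_mul_assoc)
  then have inj: "inj ((*v) A)" by (metis injI)
  obtain c where c: "c > 0" "\<And>f. f \<in> borel_measurable borel \<Longrightarrow>
      (\<integral>\<^sup>+x. f x \<partial>lborel) = ennreal c * (\<integral>\<^sup>+x. f (A *v x) \<partial>lborel)"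
    using nn_integral_linear_modulus[OF matrix_vector_mul_linear inj] by blast
  let ?g = "indicator (cbox 0 One) :: real^'n \<Rightarrow> ennreal"
  have "(\<integral>\<^sup>+x. ?g x \<partial>lborel) = ennreal c * (ennreal c * (\<integral>\<^sup>+x. ?g (A *v (A *v x)) \<partial>lborel))"
    by (subst c(2), measurable, subst c(2), measurable)
  then have "1 = ennreal (c * c)"
    using c(1) \<open>\<And>x. A *v (A *v x) = x\<close> by (simp add: ennreal_mult)
  then have "c * c = 1"
    using c(1) by (metis ennreal_1 ennreal_inj mult_nonneg_nonneg less_imp_le zero_le_one)
  then have "c = 1"
    using c(1) power2_eq_1_iff[of c] by (auto simp: power2_eq_square)
  moreover have "det A * det A = 1"
    using det_mul[of A A] by (simp add: A)
  then have "\<bar>det A\<bar> = 1" by (metis abs_square_eq_1 power2_eq_square)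
  ultimately show ?thesis using c(2)[OF f] by simp
qed

text \<open>The change of variables theorems of the library require a well-ordered index type.\<close>

lemma nn_integral_matrix:
  fixes A :: "real^'n^'n"
  assumes "invertible A" and "f \<in> borel_measurable borel"
  shows "(\<integral>\<^sup>+x. f x \<partial>lborel) = ennreal \<bar>det A\<bar> * (\<integral>\<^sup>+x. f (A *v x) \<partial>lborel)"
proof -
  \<comment> \<open>The induction over elementary factors also passes through singular matrices. The
    guard makes the zero-row case vacuous, and it descends to both factors of a product because
    determinants multiply.\<close>
  define P where "P A \<longleftrightarrow> (invertible A \<longrightarrow> (\<forall>f\<in>borel_measurable borel.
     (\<integral>\<^sup>+x. f x \<partial>lborel) = ennreal \<bar>det A\<bar> * (\<integral>\<^sup>+x. f (A *v x) \<partial>lborel)))" for A :: "real^'n^'n"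
  have mult: "P (A ** B)" if "P A" "P B" for A B :: "real^'n^'n"
    unfolding P_def
  proof (intro impI ballI)
    assume "invertible (A ** B)"
    then have inv: "invertible A" "invertible B"
      by (simp_all add: invertible_det_nz det_mul)
    fix f :: "real^'n \<Rightarrow> ennreal" assume f [measurable]: "f \<in> borel_measurable borel"
    have "(\<integral>\<^sup>+x. f x \<partial>lborel) = ennreal \<bar>det A\<bar> * (\<integral>\<^sup>+x. f (A *v x) \<partial>lborel)"
      using that(1)[unfolded P_def] inv f by blast
    also have "(\<integral>\<^sup>+x. f (A *v x) \<partial>lborel) = ennreal \<bar>det B\<bar> * (\<integral>\<^sup>+x. f (A *v (B *v x)) \<partial>lborel)"
    proof -
      have "(\<lambda>x. f (A *v x)) \<in> borel_measurable borel" by measurable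
      then show ?thesis using that(2)[unfolded P_def] inv by blast
    qed
    finally show "(\<integral>\<^sup>+x. f x \<partial>lborel) =
        ennreal \<bar>det (A ** B)\<bar> * (\<integral>\<^sup>+x. f (A ** B *v x) \<partial>lborel)"
      by (simp add: det_mul abs_mult ennreal_mult mult.assoc matrix_vector_mul_assoc)
  qed
  have diagonal: "P A" if diag: "\<And>i j. i \<noteq> j \<Longrightarrow> A $ i $ j = 0" for A
    unfolding P_def
  proof (intro impI ballI)
    assume "invertible A"
    have det: "det A = (\<Prod>i\<in>UNIV. A $ i $ i)" using diag by (rule det_diagonal)
    then have nz: "A $ i $ i \<noteq> 0" for i
      using \<open>invertible A\<close> by (auto simp: invertible_det_nz)
    \<comment> \<open>The scaling theorem \<open>lborel_affine_euclidean\<close> takes its factors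
      indexed by basis vectors; \<open>c\<close> reads off the diagonal entry belonging to
      \<open>axis i 1\<close>.\<close>
    define c where "c b = (\<Sum>i\<in>UNIV. A $ i $ i * b $ i)" for b :: "real^'n"
    have c: "c (axis i 1) = A $ i $ i" for i
      by (simp add: c_def axis_def if_distrib cong: if_cong)
    have prod_c: "(\<Prod>j\<in>Basis. \<bar>c j\<bar>) = \<bar>det A\<bar>"
      by (simp add: det Basis_vec_def c prod.reindex inj_on_def axis_eq_axis abs_prod UNION_singleton_eq_range)
    have sum_c: "(\<Sum>j\<in>Basis. (c j * (x \<bullet> j)) *\<^sub>R j) = A *v x" for x
    proof -
      have "A *v x = (\<Sum>i\<in>UNIV. (A $ i $ i * x $ i) *\<^sub>R axis i 1)"
      proof (simp add: vec_eq_iff matrix_vector_mult_def, intro allI)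
        fix i
        have "(\<Sum>j\<in>UNIV. A $ i $ j * x $ j) = (\<Sum>j\<in>UNIV. if i = j then A $ i $ i * x $ i else 0)"
          using diag by (intro sum.cong) auto
        then show "(\<Sum>j\<in>UNIV. A $ i $ j * x $ j) = (\<Sum>j\<in>UNIV. A $ j $ j * x $ j * axis j 1 $ i)"
          by (simp add: axis_def if_distrib cong: if_cong)
      qed
      then show ?thesis
        by (simp add: Basis_vec_def c sum.reindex inj_on_def axis_eq_axis inner_axis UNION_singleton_eq_range)
    qed
    fix f :: "real^'n \<Rightarrow> ennreal" assume f [measurable]: "f \<in> borel_measurable borel"
    have "lborel = density (distr lborel borel ((*v) A)) (\<lambda>_. ennreal \<bar>det A\<bar>)"
    proof -
      have "c j \<noteq> 0" if "j \<in> Basis" for j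
        using that nz by (auto simp: Basis_vec_def c)
      from lborel_affine_euclidean[of c 0, OF this] show ?thesis
        by (simp add: sum_c prod_c)
    qed
    then have "(\<integral>\<^sup>+x. f x \<partial>lborel) =
        (\<integral>\<^sup>+x. f x \<partial>density (distr lborel borel ((*v) A)) (\<lambda>_. ennreal \<bar>det A\<bar>))"
      by simp
    then show "(\<integral>\<^sup>+x. f x \<partial>lborel) = ennreal \<bar>det A\<bar> * (\<integral>\<^sup>+x. f (A *v x) \<partial>lborel)"
      by (simp add: nn_integral_density nn_integral_distr nn_integral_cmult)
  qed
  have involution: "P A" if "A ** A = mat 1" for A
    unfolding P_def using nn_integral_matrix_involution[OF that] by blast
  have "P A"
  proof (rule induct_matrix_elementary)
    show "P (A ** B)" if "P A" "P B" for A B using that by (rule mult)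
    show "P A" if "row i A = 0" for A i
      using that by (auto simp: P_def invertible_det_nz det_zero_row)
    show "P A" if "\<And>i j. i \<noteq> j \<Longrightarrow> A $ i $ j = 0" for A using that by (rule diagonal)
    show "P (\<chi> i j. mat 1 $ i $ Transposition.transpose m n j)" for m n
    proof (rule involution)
      let ?t = "Transposition.transpose m n"
      have "(\<Sum>k\<in>UNIV. mat 1 $ i $ ?t k * mat 1 $ k $ ?t j) = (mat 1 $ i $ j :: real)" for i j
      proof -
        have "(\<Sum>k\<in>UNIV. mat 1 $ i $ ?t k * mat 1 $ k $ ?t j) =
            (\<Sum>k\<in>UNIV. if k = ?t j then mat 1 $ i $ j else (0 :: real))"
          by (intro sum.cong) (auto simp: mat_def)
        then show ?thesis by simp
      qed
      then show "(\<chi> i j. mat 1 $ i $ ?t j) ** (\<chi> i j. mat 1 $ i $ ?t j) = (mat 1 :: real^'n^'n)"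
        by (simp add: vec_eq_iff matrix_matrix_mult_def)
    qed
    fix m n :: 'n and c :: real assume "m \<noteq> n"
    txt \<open>A shear is the product of a reflection and an involution.\<close>
    define D :: "real^'n^'n" where
      "D = (\<chi> i j. if i = j then (if i = m then - 1 else 1) else 0)"
    let ?S = "\<chi> i j. if i = m \<and> j = n then c else of_bool (i = j)"
    have D_mult: "D ** B = (\<chi> i. if i = m then - (B $ i) else B $ i)" for B :: "real^'n^'n"
      by (simp add: vec_eq_iff matrix_matrix_mult_def D_def if_distrib[where f="\<lambda>x. x * _"] cong: if_cong)
    have "D ** (D ** ?S) = ?S"
      by (simp add: D_mult vec_eq_iff)
    \<comment> \<open>Row \<open>m\<close> of \<open>D ** ?S\<close> has -1 in column
      \<open>m\<close> and \<open>- c\<close> in column \<open>n\<close>; the other rows are those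
      of the identity. In the square the contributions \<open>c\<close> and \<open>- c\<close> to
      entry \<open>(m, n)\<close> cancel.\<close>
    moreover have "D ** ?S ** (D ** ?S) = mat 1"
    proof -
      have "(\<Sum>k\<in>UNIV. (D ** ?S) $ i $ k * (D ** ?S) $ k $ j) = of_bool (i = j)" for i j
      proof (cases "i = m")
        case True
        have "(\<Sum>k\<in>UNIV. (D ** ?S) $ i $ k * (D ** ?S) $ k $ j) =
            (\<Sum>k\<in>{m, n}. (D ** ?S) $ i $ k * (D ** ?S) $ k $ j)"
          using True by (intro sum.mono_neutral_right) (auto simp: D_mult)
        also have "\<dots> = of_bool (i = j)"
          using \<open>m \<noteq> n\<close> True by (auto simp: D_mult)
        finally show ?thesis .
      next
        case False
        then have "(\<Sum>k\<in>UNIV. (D ** ?S) $ i $ k * (D ** ?S) $ k $ j) =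
            (\<Sum>k\<in>{i}. (D ** ?S) $ i $ k * (D ** ?S) $ k $ j)"
          by (intro sum.mono_neutral_right) (auto simp: D_mult)
        then show ?thesis using False by (simp add: D_mult)
      qed
      then show ?thesis
        by (simp add: vec_eq_iff matrix_matrix_mult_def[of "D ** ?S"] mat_def)
    qed
    ultimately show "P ?S"
      using mult[OF diagonal[of D] involution[of "D ** ?S"]] by (simp add: D_def)
  qed
  then show ?thesis using assms unfolding P_def by blast
qed

text \<open>Tested on indicators, the formula for nonnegative integrands becomes an equality of
  measures, and this carries it over to Banach-valued integrands.\<close>

lemma has_bochner_integral_lborel_linear:
  fixes A :: "real^'n^'n" and f :: "real^'n \<Rightarrow> 'b::{banach,second_countable_topology}"
  assumes A: "invertible A" and f: "f \<in> borel_measurable borel"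
    and int: "has_bochner_integral lborel (\<lambda>x. \<bar>det A\<bar> *\<^sub>R f (t + A *v x)) I"
  shows "has_bochner_integral lborel f I"
proof -
  note f [measurable]
  let ?D = "density (distr lborel borel (\<lambda>x. t + A *v x)) (\<lambda>_. ennreal \<bar>det A\<bar>)"
  have "lborel = ?D"
  proof (rule measure_eqI)
    fix S :: "(real^'n) set" assume "S \<in> sets lborel"
    then have S [measurable]: "S \<in> sets borel" by simp
    have "emeasure lborel S = (\<integral>\<^sup>+x. indicator S (t + x) \<partial>lborel)"
      by (simp add: nn_integral_lborel_shift)
    also have "\<dots> = ennreal \<bar>det A\<bar> * (\<integral>\<^sup>+x. indicator S (t + A *v x) \<partial>lborel)"
      by (rule nn_integral_matrix[OF A]) measurable
    also have "\<dots> = ennreal \<bar>det A\<bar> * (\<integral>\<^sup>+x. indicator S x \<partial>distr lborel borel (\<lambda>x. t + A *v x))"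
      by (subst nn_integral_distr) simp_all
    also have "\<dots> = emeasure ?D S"
      by (simp add: emeasure_density nn_integral_cmult)
    finally show "emeasure lborel S = emeasure ?D S" .
  qed simp
  moreover have "has_bochner_integral ?D f I"
    using int by (intro has_bochner_integral_density has_bochner_integral_distr) auto
  ultimately show ?thesis by simp
qed

subsection \<open>The standard Gaussian density\<close>

text \<open>Lebesgue measure is the image of a product of one-dimensional Lebesgue measures, and
  under a product measure factors in separate coordinates integrate separately.\<close>

lemma has_bochner_integral_lborel_prod:
  fixes g :: "'a::euclidean_space \<Rightarrow> real \<Rightarrow> real"
  assumes int: "\<And>b. b \<in> Basis \<Longrightarrow> has_bochner_integral lborel (g b) (I b)"
  shows "has_bochner_integral lborel (\<lambda>x. \<Prod>b\<in>Basis. g b (x \<bullet> b)) (\<Prod>b\<in>Basis. I b)"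
proof -
  interpret product_sigma_finite "\<lambda>_::'a. lborel :: real measure" ..
  have [measurable]: "g b \<in> borel_measurable borel" if "b \<in> Basis" for b
    using int[OF that] by (auto simp: has_bochner_integral_iff dest: borel_measurable_integrable)
  have "has_bochner_integral (Pi\<^sub>M Basis (\<lambda>_. lborel)) (\<lambda>x. \<Prod>b\<in>Basis. g b (x b)) (\<Prod>b\<in>Basis. I b)"
    using int by (simp add: has_bochner_integral_iff product_integral_prod product_integrable_prod)
  moreover have "(\<Prod>b\<in>Basis. g b ((\<Sum>i\<in>Basis. x i *\<^sub>R i) \<bullet> b)) = (\<Prod>b\<in>Basis. g b (x b))" for x
    by (intro prod.cong) auto
  ultimately show ?thesis
    by (subst lborel_eq, intro has_bochner_integral_distr) auto
qed

definition std_gaussian :: "'a::euclidean_space \<Rightarrow> real" where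
  "std_gaussian x = (\<Prod>b\<in>Basis. std_normal_density (x \<bullet> b))"

lemma std_gaussian_eq: "std_gaussian (x :: 'a::euclidean_space) = exp (- (x \<bullet> x) / 2) / sqrt ((2 * pi) ^ DIM('a))"
proof -
  have "- (x \<bullet> x) / 2 = (\<Sum>b\<in>Basis. - (x \<bullet> b)\<^sup>2 / 2)"
    by (simp add: euclidean_inner[of x x] power2_eq_square sum_negf sum_divide_distrib)
  then show ?thesis
    by (simp add: std_gaussian_def std_normal_density_def prod.distrib exp_sum real_sqrt_power
      power_one_over prod_dividef real_sqrt_mult power_mult_distrib)
qed

lemma std_gaussian_measurable [measurable]: "std_gaussian \<in> borel_measurable borel"
  unfolding std_gaussian_def by measurable

lemma std_gaussian_moments:
  fixes i j :: "'a::euclidean_space"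
  shows "has_bochner_integral lborel (std_gaussian :: 'a \<Rightarrow> real) 1"
    and "i \<in> Basis \<Longrightarrow> j \<in> Basis \<Longrightarrow>
      has_bochner_integral lborel (\<lambda>x. std_gaussian x * ((x \<bullet> i) * (x \<bullet> j))) (of_bool (i = j))"
proof -
  have m0: "has_bochner_integral lborel std_normal_density 1"
    using std_normal_moment_even[of 0] by simp
  have m1: "has_bochner_integral lborel (\<lambda>x. std_normal_density x * x) 0"
    using std_normal_moment_odd[of 0] by simp
  have m2: "has_bochner_integral lborel (\<lambda>x. std_normal_density x * (x * x)) 1"
    using std_normal_moment_even[of 1] by (simp add: power2_eq_square)
  show "has_bochner_integral lborel (std_gaussian :: 'a \<Rightarrow> real) 1"
    using has_bochner_integral_lborel_prod[OF m0] by (simp add: std_gaussian_def[abs_def])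
  assume ij: "i \<in> Basis" "j \<in> Basis"
  \<comment> \<open>Each coordinate receives one factor \<open>x\<close> for every index among
    \<open>i\<close>, \<open>j\<close> that equals it. The one-dimensional moments of order 0, 1, 2
    are 1, 0, 1, so only a coordinate hit exactly once contributes 0.\<close>
  let ?g = "\<lambda>b x. std_normal_density x * ((if b = i then x else 1) * (if b = j then x else 1))"
  have "has_bochner_integral lborel (?g b) (if (b = i) = (b = j) then 1 else 0)" for b
    using m0 m1 m2 by (cases "b = i"; cases "b = j") simp_all
  then have "has_bochner_integral lborel (\<lambda>x::'a. \<Prod>b\<in>Basis. ?g b (x \<bullet> b))
      (\<Prod>b\<in>Basis. if (b = i) = (b = j) then 1 else 0)"
    by (rule has_bochner_integral_lborel_prod)
  moreover have "(\<Prod>b\<in>Basis. ?g b (x \<bullet> b)) = std_gaussian x * ((x \<bullet> i) * (x \<bullet> j))" for x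
    using ij by (simp add: prod.distrib std_gaussian_def)
  moreover have "(\<Prod>b\<in>Basis. if (b = i) = (b = j) then 1 else 0) = (of_bool (i = j) :: real)"
    using ij by (cases "i = j") (auto intro!: prod_zero bexI[of _ i])
  ultimately show "has_bochner_integral lborel (\<lambda>x. std_gaussian x * ((x \<bullet> i) * (x \<bullet> j))) (of_bool (i = j))"
    by simp
qed

subsection \<open>Positive definite matrices\<close>

lemma sym_pos_def_invertible:
  fixes S :: "real^'n^'n"
  assumes "sym_pos_def S" shows "invertible S"
proof -
  have "v = 0" if "S *v v = 0" for v
    using assms that by (force simp: sym_pos_def_def)
  then show ?thesis
    by (metis invertible_left_inverse matrix_left_invertible_ker)
qed

text \<open>Induction on \<open>k\<close>: fewer than \<open>CARD('n)\<close> vectors do not span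
  the space, so some vector outside their span can be orthogonalised and normalised.\<close>

lemma sym_pos_def_orthonormal_family:
  fixes S :: "real^'n^'n"
  assumes S: "sym_pos_def S" and "k \<le> CARD('n)"
  shows "\<exists>B. finite B \<and> card B = k \<and> (\<forall>x\<in>B. \<forall>y\<in>B. x \<bullet> (S *v y) = of_bool (x = y))"
  using \<open>k \<le> CARD('n)\<close>
proof (induction k)
  case 0
  then show ?case by (intro exI[of _ "{}"]) simp
next
  case (Suc k)
  then obtain B where B: "finite B" "card B = k"
    and orth: "\<And>x y. x \<in> B \<Longrightarrow> y \<in> B \<Longrightarrow> x \<bullet> (S *v y) = of_bool (x = y)"
    by (auto simp: Suc_le_eq)
  have sym: "x \<bullet> (S *v y) = y \<bullet> (S *v x)" for x y
    using S by (metis dot_lmul_matrix inner_commute sym_pos_def_def transpose_matrix_vector)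
  have "dim B < DIM(real^'n)"
    using dim_le_card'[OF B(1)] B(2) Suc.prems by simp
  then have "span B \<noteq> UNIV"
    by (metis dim_span dim_UNIV less_irrefl)
  then obtain v where v: "v \<notin> span B" by auto
  txt \<open>One step of the Gram-Schmidt process for the inner product given by \<open>S\<close>.\<close>
  define w where "w = v - (\<Sum>x\<in>B. (x \<bullet> (S *v v)) *\<^sub>R x)"
  have "w \<noteq> 0"
  proof
    assume "w = 0"
    then have "v = (\<Sum>x\<in>B. (x \<bullet> (S *v v)) *\<^sub>R x)" by (simp add: w_def)
    then have "v \<in> span B" by (metis (no_types, lifting) span_base span_scale span_sum)
    with v show False by simp
  qed
  then have pos: "0 < w \<bullet> (S *v w)" using S by (simp add: sym_pos_def_def)
  define u where "u = (1 / sqrt (w \<bullet> (S *v w))) *\<^sub>R w"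
  have uu: "u \<bullet> (S *v u) = 1"
    using pos by (simp add: u_def matrix_vector_mult_scaleR)
  have "y \<bullet> (S *v w) = 0" if "y \<in> B" for y
  proof -
    have "y \<bullet> (S *v w) = y \<bullet> (S *v v) - (\<Sum>x\<in>B. (x \<bullet> (S *v v)) * (y \<bullet> (S *v x)))"
      by (simp add: w_def matrix_vector_mult_diff_distrib inner_diff_right linear_sum[OF matrix_vector_mul_linear]
          inner_sum_right matrix_vector_mult_scaleR)
    also have "(\<Sum>x\<in>B. (x \<bullet> (S *v v)) * (y \<bullet> (S *v x))) = (\<Sum>x\<in>B. if x = y then y \<bullet> (S *v v) else 0)"
      using that orth by (intro sum.cong) auto
    finally show ?thesis using that B(1) by simp
  qed
  then have yu: "y \<bullet> (S *v u) = 0" if "y \<in> B" for y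
    using that by (simp add: u_def matrix_vector_mult_scaleR)
  have "u \<notin> B" using yu uu by force
  have uy: "u \<bullet> (S *v y) = 0" if "y \<in> B" for y
    using yu[OF that] sym by metis
  have "\<forall>x\<in>insert u B. \<forall>y\<in>insert u B. x \<bullet> (S *v y) = of_bool (x = y)"
    using \<open>u \<notin> B\<close> orth uu yu uy by auto
  moreover have "card (insert u B) = Suc k" using B \<open>u \<notin> B\<close> by simp
  ultimately show ?case using B(1) by blast
qed

text \<open>If the rows of \<open>K\<close> are orthonormal for the inner product given by
  \<open>S\<close>, then \<open>K ** S ** transpose K\<close> is the identity, and the inverse of
  \<open>K\<close> serves as \<open>L\<close>.\<close>

lemma sym_pos_def_factor:
  fixes S :: "real^'n^'n"
  assumes S: "sym_pos_def S"
  obtains L :: "real^'n^'n" where "invertible L" "S = L ** transpose L"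
proof -
  obtain B where B: "finite B" "card B = CARD('n)"
    and orth: "\<And>x y. x \<in> B \<Longrightarrow> y \<in> B \<Longrightarrow> x \<bullet> (S *v y) = of_bool (x = y)"
    using sym_pos_def_orthonormal_family[OF S order_refl] by blast
  obtain h :: "'n \<Rightarrow> real^'n" where h: "bij_betw h UNIV B"
    using B by (metis finite_same_card_bij finite)
  define K where "K = (\<chi> i. h i)"
  have KSK: "K ** S ** transpose K = mat 1"
  proof -
    have "(K ** (S ** transpose K)) $ i $ j = h i \<bullet> (S *v h j)" for i j
      by (simp add: K_def matrix_matrix_mult_def inner_vec_def matrix_vector_mult_def transpose_def)
    moreover have "h i = h j \<longleftrightarrow> i = j" "h i \<in> B" for i j
      using h by (auto simp: bij_betw_def inj_on_def)
    ultimately have "K ** (S ** transpose K) = mat 1"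
      using orth by (simp add: vec_eq_iff mat_def)
    then show ?thesis by (simp only: matrix_mul_assoc)
  qed
  have "det K \<noteq> 0"
    using arg_cong[OF KSK, of det] by (auto simp: det_mul)
  then have K: "invertible K" by (simp add: invertible_det_nz)
  then obtain L where L: "K ** L = mat 1" "L ** K = mat 1" by (auto simp: invertible_def)
  have Lt: "transpose K ** transpose L = mat 1"
    by (metis L(2) matrix_transpose_mul transpose_mat)
  have "L ** transpose L = L ** (K ** S ** transpose K) ** transpose L"
    by (simp add: KSK)
  also have "\<dots> = (L ** K) ** S ** (transpose K ** transpose L)"
    by (simp add: matrix_mul_assoc)
  finally have "S = L ** transpose L" by (simp add: L Lt)
  moreover have "invertible L" using L by (auto simp: invertible_def)
  ultimately show ?thesis using that by blast
qed

lemma matrix_inv_mult: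
  fixes A :: "real^'n^'n"
  assumes "invertible A"
  shows "matrix_inv A ** A = mat 1" "A ** matrix_inv A = mat 1"
    "matrix_inv A *v (A *v x) = x" "A *v (matrix_inv A *v x) = x"
proof -
  have "A ** matrix_inv A = mat 1 \<and> matrix_inv A ** A = mat 1"
    unfolding matrix_inv_def by (rule someI_ex) (use assms in \<open>simp add: invertible_def\<close>)
  then show "matrix_inv A ** A = mat 1" "A ** matrix_inv A = mat 1"
    "matrix_inv A *v (A *v x) = x" "A *v (matrix_inv A *v x) = x"
    by (simp_all add: matrix_vector_mul_assoc)
qed

lemma symmetric_inner:
  fixes A :: "real^'n^'n"
  assumes "transpose A = A" shows "(A *v x) \<bullet> y = x \<bullet> (A *v y)"
  using assms by (metis dot_lmul_matrix transpose_matrix_vector)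

lemma sym_pos_def_matrix_inv:
  fixes S :: "real^'n^'n"
  assumes "sym_pos_def S" shows "sym_pos_def (matrix_inv S)"
proof -
  have inv: "invertible S" and tr: "transpose S = S"
    using assms by (simp_all add: sym_pos_def_invertible sym_pos_def_def)
  note [simp] = matrix_inv_mult[OF inv]
  have "transpose (matrix_inv S) = matrix_inv S"
  proof -
    have "transpose (matrix_inv S) ** S = mat 1"
      by (metis matrix_inv_mult(2)[OF inv] matrix_transpose_mul tr transpose_mat)
    then have "transpose (matrix_inv S) ** S ** matrix_inv S = matrix_inv S" by simp
    then show ?thesis by (simp flip: matrix_mul_assoc)
  qed
  moreover have "0 < v \<bullet> (matrix_inv S *v v)" if "v \<noteq> 0" for v
  proof -
    have "matrix_inv S *v v \<noteq> 0"
      using that matrix_inv_mult(4)[OF inv, of v] by force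
    then have "0 < (matrix_inv S *v v) \<bullet> (S *v (matrix_inv S *v v))"
      using assms unfolding sym_pos_def_def by blast
    then show ?thesis by (simp add: inner_commute)
  qed
  ultimately show ?thesis by (simp add: sym_pos_def_def)
qed

text \<open>Cancelling \<open>L\<close> in \<open>L ** transpose L ** matrix_inv S ** L = L\<close>
  leaves \<open>transpose L ** matrix_inv S ** L = mat 1\<close>: the factor \<open>L\<close>
  whitens the quadratic form.\<close>

lemma factor_inner_inverse:
  fixes S L :: "real^'n^'n"
  assumes L: "invertible L" and S: "S = L ** transpose L"
  shows "(L *v z) \<bullet> (matrix_inv S *v (L *v z)) = z \<bullet> z"
proof -
  have "invertible S"
    using L by (simp add: S invertible_det_nz det_mul)
  moreover have "L *v (transpose L *v y) = S *v y" for y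
    by (simp only: S matrix_vector_mul_assoc)
  ultimately have "L *v (transpose L *v (matrix_inv S *v (L *v z))) = L *v z"
    by (simp add: matrix_inv_mult)
  then have "transpose L *v (matrix_inv S *v (L *v z)) = z"
    by (metis L matrix_inv_mult(3))
  then show ?thesis
    by (metis dot_lmul_matrix transpose_matrix_vector transpose_transpose)
qed

lemma sym_pos_def_det:
  fixes S :: "real^'n^'n"
  assumes "sym_pos_def S" shows "det S > 0"
proof -
  obtain L :: "real^'n^'n" where "invertible L" "S = L ** transpose L"
    using sym_pos_def_factor[OF assms] .
  then show ?thesis
    by (auto simp: det_mul invertible_det_nz zero_less_mult_iff)
qed

subsection \<open>Moments of the normal density\<close>

lemma mvn_density_pos:
  fixes S :: "real^'n^'n"
  assumes "sym_pos_def S" shows "mvn_density S m x > 0"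
  using sym_pos_def_det[OF assms] by (simp add: mvn_density_def)

lemma mvn_density_measurable [measurable]:
  fixes S :: "real^'n^'n"
  shows "mvn_density S m \<in> borel_measurable borel"
  unfolding mvn_density_def[abs_def] by measurable

lemma ln_mvn_density:
  fixes S :: "real^'n^'n"
  assumes "sym_pos_def S"
  shows "ln (mvn_density S m x) =
    - ((x - m) \<bullet> (matrix_inv S *v (x - m))) / 2 - ln (sqrt ((2 * pi) ^ CARD('n) * det S))"
  using sym_pos_def_det[OF assms] by (simp add: mvn_density_def ln_div)

text \<open>The determinant of \<open>S\<close> is the square of \<open>det L\<close>, so the
  Jacobian cancels the determinant in the normalising constant.\<close>

lemma mvn_density_factor:
  fixes S L :: "real^'n^'n"
  assumes L: "invertible L" and S: "S = L ** transpose L"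
  shows "\<bar>det L\<bar> * mvn_density S m (m + L *v z) = std_gaussian z"
proof -
  have "det L \<noteq> 0" using L by (simp add: invertible_det_nz)
  moreover have "det S = (det L)\<^sup>2"
    by (simp add: S det_mul power2_eq_square)
  ultimately show ?thesis
    by (simp add: mvn_density_def std_gaussian_eq factor_inner_inverse[OF L S] real_sqrt_mult)
qed

text \<open>This is the substitution \<open>x = m + L *v z\<close>. Values in a Banach space are
  allowed because the Fisher information is a matrix-valued integral.\<close>

lemma has_bochner_integral_mvn_density:
  fixes S L :: "real^'n^'n" and g :: "real^'n \<Rightarrow> 'b::{banach,second_countable_topology}"
  assumes L: "invertible L" and S: "S = L ** transpose L" and g [measurable]: "g \<in> borel_measurable borel"
    and int: "has_bochner_integral lborel (\<lambda>z. std_gaussian z *\<^sub>R g (m + L *v z)) I"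
  shows "has_bochner_integral lborel (\<lambda>x. mvn_density S m x *\<^sub>R g x) I"
proof (rule has_bochner_integral_lborel_linear[OF L, where t = m])
  show "has_bochner_integral lborel
      (\<lambda>x. \<bar>det L\<bar> *\<^sub>R mvn_density S m (m + L *v x) *\<^sub>R g (m + L *v x)) I"
    using int by (simp add: mvn_density_factor[OF L S])
qed measurable

lemma has_bochner_integral_mvn_density_1:
  fixes S :: "real^'n^'n"
  assumes S: "sym_pos_def S"
  shows "has_bochner_integral lborel (mvn_density S m) 1"
proof -
  obtain L :: "real^'n^'n" where L: "invertible L" "S = L ** transpose L"
    using sym_pos_def_factor[OF S] .
  show ?thesis
    using has_bochner_integral_mvn_density[OF L, of "\<lambda>_. 1::real"] std_gaussian_moments(1) by simp
qed

text \<open>The two centres may differ because the EM objective pairs the density of one parameter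
  with the logarithm for another. In whitened coordinates the form is the squared norm of
  \<open>z + w\<close>, where \<open>w\<close> is the displacement of the centres.\<close>

lemma integrable_mvn_density_quadratic:
  fixes S :: "real^'n^'n"
  assumes S: "sym_pos_def S"
  shows "integrable lborel (\<lambda>x. mvn_density S m x * ((x - m') \<bullet> (matrix_inv S *v (x - m'))))"
proof -
  obtain L :: "real^'n^'n" where L: "invertible L" "S = L ** transpose L"
    using sym_pos_def_factor[OF S] .
  define w where "w = matrix_inv L *v (m - m')"
  have w: "m + L *v z - m' = L *v (z + w)" for z
    by (simp add: w_def matrix_vector_right_distrib matrix_inv_mult(4)[OF L(1)])
  have "integrable lborel (\<lambda>z::real^'n. std_gaussian z * (2 * (z \<bullet> z) + 2 * (w \<bullet> w)) :: real)"
  proof -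
    have "has_bochner_integral lborel (\<lambda>z::real^'n. \<Sum>b\<in>Basis. std_gaussian z * ((z \<bullet> b) * (z \<bullet> b))) 
       (\<Sum>b\<in>Basis. of_bool (b = (b :: real^'n)))"
      by (intro has_bochner_integral_sum std_gaussian_moments(2))
    then have "integrable lborel (\<lambda>z::real^'n. std_gaussian z * (z \<bullet> z))"
      by (simp add: has_bochner_integral_iff sum_distrib_left[symmetric] flip: euclidean_inner)
    moreover have "integrable lborel (std_gaussian :: real^'n \<Rightarrow> real)"
      using std_gaussian_moments(1) by (rule integrable.intros)
    ultimately have "integrable lborel (\<lambda>z::real^'n. 2 * (std_gaussian z * (z \<bullet> z)) + 2 * (w \<bullet> w) * std_gaussian z)"
      by (intro Bochner_Integration.integrable_add integrable_mult_right) auto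
    then show ?thesis by (simp add: algebra_simps)
  qed
  then have "integrable lborel (\<lambda>z::real^'n. std_gaussian z * ((z + w) \<bullet> (z + w)) :: real)"
  proof (rule Bochner_Integration.integrable_bound)
    have "std_gaussian z \<ge> 0" for z :: "real^'n"
      by (simp add: std_gaussian_eq)
    \<comment> \<open>The difference of the two sides is the squared norm of
      \<open>z - w\<close>.\<close>
    moreover have "(z + w) \<bullet> (z + w) \<le> 2 * (z \<bullet> z) + 2 * (w \<bullet> w)" for z
      using inner_ge_zero[of "z - w"] by (simp add: inner_simps inner_commute)
    ultimately show "AE z in lborel. norm (std_gaussian z * ((z + w) \<bullet> (z + w)))
        \<le> norm (std_gaussian z * (2 * (z \<bullet> z) + 2 * (w \<bullet> w)))"
      by (simp add: abs_mult mult_left_mono)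
  qed measurable
  then have "has_bochner_integral lborel (\<lambda>x. mvn_density S m x *\<^sub>R ((x - m') \<bullet> (matrix_inv S *v (x - m'))))
      (\<integral>z. std_gaussian z * ((z + w) \<bullet> (z + w)) \<partial>lborel)"
    by (intro has_bochner_integral_mvn_density[OF L])
      (simp_all add: w factor_inner_inverse[OF L] has_bochner_integral_integrable)
  then show ?thesis by (simp add: has_bochner_integral_iff)
qed

section \<open>Gradients of quadratic functions\<close>

lemma gradient_eq: "GDERIV f a :> D \<Longrightarrow> gradient f a = D"
  unfolding gradient_def
proof (rule the_equality)
  fix E assume "GDERIV f a :> D" "GDERIV f a :> E"
  then have "(\<lambda>h. h \<bullet> D) = (\<lambda>h. h \<bullet> E)"
    unfolding gderiv_def by (rule has_derivative_unique)
  then show "E = D" by (metis inner_commute vector_eq_rdot)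
qed

text \<open>Symmetry makes the two terms of the product rule equal, which absorbs the factor 1/2.
  The general shape covers the log density, \<open>f\<close> and the EM objective.\<close>

lemma GDERIV_quadratic:
  fixes A :: "real^'n^'n"
  assumes "transpose A = A"
  shows "GDERIV (\<lambda>x. (x - a) \<bullet> (A *v (x - a)) / 2 + b \<bullet> x + c) x :> A *v (x - a) + b"
proof -
  have [simp]: "h \<bullet> (A *v (x - a)) = (x - a) \<bullet> (A *v h)" for h
    using symmetric_inner[OF assms] by (metis inner_commute)
  have "((*v) A has_derivative (*v) A) F" for F
    by (simp add: linear_imp_has_derivative)
  note der = has_derivative_compose[OF _ this]
  show ?thesis
    unfolding gderiv_def
    by (auto intro!: derivative_eq_intros der simp: fun_eq_iff inner_simps inner_commute[of _ b])
qed

section \<open>Covariance of the score and the Fisher information\<close>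

definition outer :: "real^'n \<Rightarrow> real^'n^'n" where
  "outer s = (\<chi> i j. s $ i * s $ j)"

lemma outer_measurable [measurable]: "outer \<in> borel_measurable borel"
  unfolding outer_def
  by (intro borel_measurable_continuous_onI continuous_intros)

lemma outer_mult: "outer (B *v z) = B ** outer z ** transpose B"
  by (simp add: outer_def vec_eq_iff matrix_matrix_mult_def matrix_vector_mult_def transpose_def
      sum_product sum_distrib_left sum_distrib_right mult_ac)

lemma std_gaussian_outer:
  "has_bochner_integral lborel (\<lambda>z. std_gaussian z *\<^sub>R outer z) (mat 1 :: real^'n^'n)"
proof -
  \<comment> \<open>The matrix-valued integral is assembled from scalar second moments along the
    matrix units \<open>axis i (axis j 1)\<close>.\<close>
  have "has_bochner_integral lborel
      (\<lambda>z::real^'n. \<Sum>i\<in>UNIV. \<Sum>j\<in>UNIV. (std_gaussian z * ((z \<bullet> axis i 1) * (z \<bullet> axis j 1))) *\<^sub>R axis i (axis j 1))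
      (\<Sum>i\<in>UNIV. \<Sum>j\<in>UNIV. of_bool (axis i 1 = (axis j 1 :: real^'n)) *\<^sub>R axis i (axis j (1::real)))"
    by (intro has_bochner_integral_sum has_bochner_integral_scaleR_left std_gaussian_moments(2)) auto
  moreover have "(\<Sum>i\<in>UNIV. \<Sum>j\<in>UNIV. c i j *\<^sub>R axis i (axis j (1::real))) = (\<chi> i j. c i j)" for c :: "'n \<Rightarrow> 'n \<Rightarrow> real"
  proof -
    have "(c i j *\<^sub>R axis i (axis j (1::real))) $ k $ l = (if j = l then if i = k then c k l else 0 else 0)" for i j k l
      by (simp add: axis_def)
    then show ?thesis
      by (simp add: vec_eq_iff sum_component del: vector_scaleR_component)
  qed
  ultimately have "has_bochner_integral lborel (\<lambda>z::real^'n. \<chi> i j. std_gaussian z * (z $ i * z $ j))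
    (\<chi> i j. of_bool (axis i 1 = (axis j 1 :: real^'n)))"
    by (simp add: inner_axis)
  moreover have "(\<chi> i j. of_bool (axis i 1 = (axis j 1 :: real^'n))) = (mat 1 :: real^'n^'n)"
    by (simp add: mat_def axis_eq_axis of_bool_def)
  moreover have "(\<chi> i j. std_gaussian z * (z $ i * z $ j)) = std_gaussian z *\<^sub>R outer z" for z :: "real^'n"
    by (simp add: vec_eq_iff outer_def)
  ultimately show ?thesis by simp
qed

lemma has_bochner_integral_law:
  fixes g :: "'x::euclidean_space \<Rightarrow> 'b::{banach,second_countable_topology}"
  assumes "\<And>x. p \<theta> x \<ge> 0" and [measurable]: "p \<theta> \<in> borel_measurable borel" "g \<in> borel_measurable borel"
    and "has_bochner_integral lborel (\<lambda>x. p \<theta> x *\<^sub>R g x) I"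
  shows "has_bochner_integral (law p \<theta>) g I"
  unfolding law_def by (rule has_bochner_integral_density) (use assms in auto)

lemma fisher_information_mvn_density:
  fixes S :: "real^'n^'n"
  assumes S: "sym_pos_def S"
  shows "fisher_information (mvn_density S) \<theta> = matrix_inv S"
proof -
  let ?P = "matrix_inv S"
  obtain L :: "real^'n^'n" where L: "invertible L" "S = L ** transpose L"
    using sym_pos_def_factor[OF S] .
  have P: "transpose ?P = ?P"
    using sym_pos_def_matrix_inv[OF S] by (simp add: sym_pos_def_def)
  have score: "gradient (\<lambda>\<eta>. ln (mvn_density S \<eta> x)) \<theta> = ?P *v (x - \<theta>)" for x
  proof (rule gradient_eq)
    let ?c = "ln (sqrt ((2 * pi) ^ CARD('n) * det S))"
    \<comment> \<open>The quadratic form is even, so it can be centred at \<open>x\<close> and read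
      as a function of the parameter \<open>\<eta>\<close>.\<close>
    have "ln (mvn_density S \<eta> x) = - ((\<eta> - x) \<bullet> (?P *v (\<eta> - x)) / 2 + 0 \<bullet> \<eta> + ?c)" for \<eta>
    proof -
      have "?P *v (\<eta> - x) = - (?P *v (x - \<eta>))"
        by (simp add: matrix_vector_mult_diff_distrib)
      then have "(\<eta> - x) \<bullet> (?P *v (\<eta> - x)) = (- (x - \<eta>)) \<bullet> (- (?P *v (x - \<eta>)))"
        by (simp only: minus_diff_eq)
      then show ?thesis by (simp only: ln_mvn_density[OF S] inner_minus_left inner_minus_right) simp
    qed
    moreover have "GDERIV (\<lambda>\<eta>. - ((\<eta> - x) \<bullet> (?P *v (\<eta> - x)) / 2 + 0 \<bullet> \<eta> + ?c)) \<theta> :> - (?P *v (\<theta> - x) + 0)"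
      by (intro GDERIV_minus GDERIV_quadratic P)
    ultimately show "GDERIV (\<lambda>\<eta>. ln (mvn_density S \<eta> x)) \<theta> :> ?P *v (x - \<theta>)"
      by (simp add: matrix_vector_mult_diff_distrib)
  qed
  \<comment> \<open>After the substitution \<open>x = \<theta> + L *v z\<close> the score is
    \<open>?B *v z\<close> with \<open>z\<close> standard Gaussian, so its covariance is
    \<open>?B ** transpose ?B\<close>.\<close>
  let ?B = "?P ** L"
  have lin: "bounded_linear (\<lambda>M. ?B ** M ** transpose ?B)"
    unfolding linear_conv_bounded_linear[symmetric]
  proof (rule linearI)
    have add: "(M + N) ** R = M ** R + N ** R" for M N R :: "real^'n^'n"
      by (simp add: vec_eq_iff matrix_matrix_mult_def distrib_right sum.distrib)
    show "?B ** (M + N) ** transpose ?B = ?B ** M ** transpose ?B + ?B ** N ** transpose ?B" for M N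
      by (simp only: matrix_add_ldistrib add)
    show "?B ** (r *\<^sub>R M) ** transpose ?B = r *\<^sub>R (?B ** M ** transpose ?B)" for r M
      by (simp only: matrix_scalar_ac scalar_matrix_assoc)
  qed
  have "has_bochner_integral lborel (\<lambda>x. mvn_density S \<theta> x *\<^sub>R outer (?P *v (x - \<theta>))) ?P"
  proof (rule has_bochner_integral_mvn_density[OF L])
    show "(\<lambda>x. outer (?P *v (x - \<theta>))) \<in> borel_measurable borel"
      by measurable
    have "has_bochner_integral lborel (\<lambda>z. ?B ** (std_gaussian z *\<^sub>R outer z) ** transpose ?B)
        (?B ** mat 1 ** transpose ?B)"
      by (rule has_bochner_integral_bounded_linear[OF lin std_gaussian_outer])
    moreover have "?B ** mat 1 ** transpose ?B = ?P"
    proof -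
      have "?B ** transpose ?B = ?P ** (L ** transpose L) ** ?P"
        by (simp add: matrix_transpose_mul P matrix_mul_assoc)
      also have "\<dots> = ?P ** S ** ?P" by (simp only: L(2)[symmetric])
      finally have "?B ** transpose ?B = ?P ** S ** ?P" .
      then show ?thesis
        using matrix_inv_mult(1)[OF sym_pos_def_invertible[OF S]] by simp
    qed
    moreover have "?B ** (std_gaussian z *\<^sub>R outer z) ** transpose ?B =
        std_gaussian z *\<^sub>R outer (?P *v (\<theta> + L *v z - \<theta>))" for z
      using linear_scale[OF bounded_linear.linear[OF lin]]
      by (simp add: outer_mult matrix_vector_mul_assoc)
    ultimately show "has_bochner_integral lborel
        (\<lambda>z. std_gaussian z *\<^sub>R outer (?P *v (\<theta> + L *v z - \<theta>))) ?P"
      by simp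
  qed
  then have "has_bochner_integral (law (mvn_density S) \<theta>) (\<lambda>x. outer (?P *v (x - \<theta>))) ?P"
    by (intro has_bochner_integral_law)
      (simp_all add: mvn_density_pos[OF S] less_imp_le)
  then show ?thesis
    by (simp add: fisher_information_def score Let_def outer_def has_bochner_integral_integral_eq)
qed

subsection \<open>The EM objective\<close>

text \<open>Both densities have the same term quadratic in \<open>x\<close>, so moving the mean only
  multiplies by the exponential of an affine function of \<open>x\<close>.\<close>

lemma mvn_density_shift:
  fixes S :: "real^'n^'n"
  assumes S: "sym_pos_def S"
  shows "mvn_density S (m + u) x =
    mvn_density S m x * exp ((x - m) \<bullet> (matrix_inv S *v u) - u \<bullet> (matrix_inv S *v u) / 2)"
proof -
  let ?P = "matrix_inv S"
  have P: "transpose ?P = ?P"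
    using sym_pos_def_matrix_inv[OF S] by (simp add: sym_pos_def_def)
  define y where "y = x - m"
  have "u \<bullet> (?P *v y) = y \<bullet> (?P *v u)"
    using symmetric_inner[OF P, of y u] by (simp add: inner_commute)
  then have "(y - u) \<bullet> (?P *v (y - u)) = y \<bullet> (?P *v y) - 2 * (y \<bullet> (?P *v u)) + u \<bullet> (?P *v u)"
    by (simp add: matrix_vector_mult_diff_distrib inner_diff_left inner_diff_right)
  moreover have "x - (m + u) = y - u" by (simp add: y_def)
  ultimately have E: "- ((x - (m + u)) \<bullet> (?P *v (x - (m + u)))) / 2 =
      - (y \<bullet> (?P *v y)) / 2 + (y \<bullet> (?P *v u) - u \<bullet> (?P *v u) / 2)"
    by (simp add: field_simps)
  show ?thesis
    unfolding mvn_density_def E exp_add by (simp add: y_def)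
qed

text \<open>A zero integral would make \<open>g\<close> vanish almost everywhere, so the whole space
  would be a null set.\<close>

lemma integral_lborel_pos:
  fixes g :: "'a::euclidean_space \<Rightarrow> real"
  assumes "integrable lborel g" and pos: "\<And>x. g x > 0"
  shows "(\<integral>x. g x \<partial>lborel) > 0"
proof -
  have "(\<integral>x. g x \<partial>lborel) \<noteq> 0"
  proof
    assume "(\<integral>x. g x \<partial>lborel) = 0"
    then have "AE x in lborel. g x = 0"
      using assms by (subst (asm) integral_nonneg_eq_0_iff_AE) (auto simp: less_imp_le)
    then have "AE x in lborel. (x :: 'a) \<in> {}"
      using pos by (auto elim!: eventually_mono simp: less_le)
    then show False
      by (simp add: AE_iff_measurable[OF _ refl])
  qed
  moreover have "(\<integral>x. g x \<partial>lborel) \<ge> 0"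
    using pos by (intro integral_nonneg_AE) (auto simp: less_imp_le)
  ultimately show ?thesis by simp
qed

text \<open>By Jensen's inequality the EM objective majorises \<open>f\<close> up to a constant and touches it at the
  current iterate. Hence both have the same gradient there, which determines the linear part of
  the objective without differentiating under the integral.\<close>

lemma em_objective_mvn_density:
  fixes S :: "real^'n^'n"
  assumes S: "sym_pos_def S" and em: "em_setting (mvn_density S) G f"
    and f': "GDERIV f \<theta>' :> g"
  obtains K where "\<And>\<theta>. em_objective (mvn_density S) G \<theta>' \<theta> =
    (\<theta> - (\<theta>' - S *v g)) \<bullet> (matrix_inv S *v (\<theta> - (\<theta>' - S *v g))) / 2 + K"
proof -
  let ?p = "mvn_density S" and ?P = "matrix_inv S"
  let ?J = "em_objective ?p G \<theta>'"
  have P: "transpose ?P = ?P"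
    using sym_pos_def_matrix_inv[OF S] by (simp add: sym_pos_def_def)
  note [simp] = matrix_inv_mult[OF sym_pos_def_invertible[OF S]]
  have p_pos: "?p \<theta> x > 0" for \<theta> x using S by (rule mvn_density_pos)
  have G [measurable]: "G \<in> borel_measurable borel" and G_pos: "G x > 0" for x
    using em by (auto simp: em_setting_def)
  define Z where "Z \<theta> = (\<integral>x. G x * ?p \<theta> x \<partial>lborel)" for \<theta>
  have int_Gp: "integrable lborel (\<lambda>x. G x * ?p \<theta> x)"
    and Z: "(\<integral>x. G x \<partial>law ?p \<theta>) = Z \<theta>" for \<theta>
  proof -
    have "integrable (law ?p \<theta>) G" using em by (simp add: em_setting_def)
    then show "integrable lborel (\<lambda>x. G x * ?p \<theta> x)"
      unfolding law_def
      by (subst (asm) integrable_density) (simp_all add: p_pos less_imp_le mult.commute)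
    show "(\<integral>x. G x \<partial>law ?p \<theta>) = Z \<theta>"
      unfolding law_def Z_def
      by (subst integral_density) (simp_all add: p_pos less_imp_le mult.commute)
  qed
  have Z_pos: "Z \<theta> > 0" for \<theta>
    unfolding Z_def by (intro integral_lborel_pos int_Gp) (simp add: G_pos p_pos)
  have f: "f \<theta> = - ln (Z \<theta>)" for \<theta>
    using em Z by (simp add: em_setting_def)
  define q where "q x = G x * ?p \<theta>' x / Z \<theta>'" for x
  have q_pos: "q x > 0" for x by (simp add: q_def G_pos p_pos Z_pos)
  have int_q: "integrable lborel q" and integral_q: "(\<integral>x. q x \<partial>lborel) = 1"
    using int_Gp[of \<theta>'] Z_pos[of \<theta>'] by (auto simp: q_def[abs_def] Z_def)
  have em_q: "em_q ?p G \<theta>' = q" by (simp add: fun_eq_iff em_q_def q_def Z)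
  \<comment> \<open>This is the log-likelihood ratio of \<open>\<theta>\<close> against
    \<open>\<theta>'\<close>, affine in \<open>x\<close>.\<close>
  define d where "d \<theta> x = (x - \<theta>') \<bullet> (?P *v (\<theta> - \<theta>')) - (\<theta> - \<theta>') \<bullet> (?P *v (\<theta> - \<theta>')) / 2" for \<theta> x
  have p_d: "?p \<theta> x = ?p \<theta>' x * exp (d \<theta> x)" for \<theta> x
    using mvn_density_shift[OF S, of \<theta>' "\<theta> - \<theta>'" x] by (simp add: d_def)
  have int_ln: "integrable lborel (\<lambda>x. q x * ln (G x * ?p \<theta> x))" for \<theta>
    using em unfolding em_setting_def em_q[symmetric] by blast
  \<comment> \<open>The logarithms of \<open>G\<close> cancel, so \<open>d\<close> is integrable
    against \<open>q\<close> although \<open>ln (G x)\<close> alone is not assumed to be.\<close>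
  have qd: "q x * d \<theta> x = q x * ln (G x * ?p \<theta> x) - q x * ln (G x * ?p \<theta>' x)" for \<theta> x
    using p_pos[of \<theta>' x] G_pos[of x] by (simp add: p_d[of \<theta>] ln_mult right_diff_distrib[symmetric])
  have int_d: "integrable lborel (\<lambda>x. q x * d \<theta> x)"
    and integral_d: "(\<integral>x. q x * d \<theta> x \<partial>lborel) = ?J \<theta>' - ?J \<theta>" for \<theta>
    unfolding qd using int_ln by (auto simp: em_objective_def em_q)

  \<comment> \<open>For the parameter \<open>\<theta>' + S *v v\<close> the linear part of
    \<open>d\<close> is exactly the inner product with \<open>v\<close>; so \<open>q\<close> has
    first moments.\<close>
  have int_inner: "integrable lborel (\<lambda>x. q x * ((x - \<theta>') \<bullet> v))" for v
  proof -
    have "integrable lborel (\<lambda>x. q x * d (\<theta>' + S *v v) x + ((S *v v) \<bullet> v / 2) * q x)"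
      by (intro Bochner_Integration.integrable_add integrable_mult_right int_d int_q)
    then show ?thesis by (simp add: d_def algebra_simps)
  qed
  define \<nu> where "\<nu> = (\<Sum>b\<in>Basis. (\<integral>x. q x * ((x - \<theta>') \<bullet> b) \<partial>lborel) *\<^sub>R b)"
  have \<nu>: "(\<integral>x. q x * ((x - \<theta>') \<bullet> v) \<partial>lborel) = \<nu> \<bullet> v" for v
  proof -
    have "(\<integral>x. q x * ((x - \<theta>') \<bullet> v) \<partial>lborel) =
        (\<integral>x. (\<Sum>b\<in>Basis. (v \<bullet> b) * (q x * ((x - \<theta>') \<bullet> b))) \<partial>lborel)"
      by (intro Bochner_Integration.integral_cong refl, subst euclidean_inner)
        (simp add: sum_distrib_left mult_ac)
    also have "\<dots> = (\<Sum>b\<in>Basis. (v \<bullet> b) * (\<integral>x. q x * ((x - \<theta>') \<bullet> b) \<partial>lborel))"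
      by (simp add: int_inner)
    also have "\<dots> = \<nu> \<bullet> v"
      by (simp add: \<nu>_def inner_sum_left inner_commute[of v] mult.commute)
    finally show ?thesis .
  qed
  \<comment> \<open>Completing the square: \<open>\<theta>' + \<nu>\<close> is the mean of
    \<open>q\<close>.\<close>
  have J: "?J \<theta> = (\<theta> - (\<theta>' + \<nu>)) \<bullet> (?P *v (\<theta> - (\<theta>' + \<nu>))) / 2 + (?J \<theta>' - \<nu> \<bullet> (?P *v \<nu>) / 2)" for \<theta>
  proof -
    define u where "u = \<theta> - \<theta>'"
    have "?J \<theta>' - ?J \<theta> = (\<integral>x. q x * ((x - \<theta>') \<bullet> (?P *v u)) - (u \<bullet> (?P *v u) / 2) * q x \<partial>lborel)"
      unfolding integral_d[symmetric] by (simp add: d_def u_def algebra_simps)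
    also have "\<dots> = \<nu> \<bullet> (?P *v u) - u \<bullet> (?P *v u) / 2"
      by (simp add: int_inner int_q \<nu> integral_q)
    finally have "?J \<theta> = ?J \<theta>' - \<nu> \<bullet> (?P *v u) + u \<bullet> (?P *v u) / 2" by simp
    moreover have "u \<bullet> (?P *v \<nu>) = \<nu> \<bullet> (?P *v u)"
      using symmetric_inner[OF P, of u \<nu>] by (simp add: inner_commute)
    moreover have "\<theta> - (\<theta>' + \<nu>) = u - \<nu>" by (simp add: u_def)
    ultimately show ?thesis
      by (simp add: matrix_vector_mult_diff_distrib inner_diff_left inner_diff_right field_simps)
  qed

  have majorise: "?J \<theta>' - f \<theta>' \<le> ?J \<theta> - f \<theta>" for \<theta>
  proof -
    \<comment> \<open>This is the mean of \<open>d \<theta>\<close> under \<open>q\<close>.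
      Integrating the tangent line of \<open>exp\<close> at \<open>?h\<close> gives Jensen's
      inequality.\<close>
    let ?h = "?J \<theta>' - ?J \<theta>"
    have Gp: "q x * exp (d \<theta> x) = G x * ?p \<theta> x / Z \<theta>'" for x
      by (simp add: q_def p_d[of \<theta>])
    have "exp ?h = (\<integral>x. exp ?h * ((1 - ?h) * q x + q x * d \<theta> x) \<partial>lborel)"
      using int_d[of \<theta>] int_q integral_d[of \<theta>] integral_q by simp
    also have "\<dots> \<le> (\<integral>x. q x * exp (d \<theta> x) \<partial>lborel)"
    proof (rule integral_mono)
      show "integrable lborel (\<lambda>x. exp ?h * ((1 - ?h) * q x + q x * d \<theta> x))"
        using int_d int_q by simp
      show "integrable lborel (\<lambda>x. q x * exp (d \<theta> x))"
        using int_Gp[of \<theta>] by (simp add: Gp)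
      fix x
      have "exp ?h * (1 + (d \<theta> x - ?h)) \<le> exp ?h * exp (d \<theta> x - ?h)"
        by (intro mult_left_mono exp_ge_add_one_self) simp
      also have "\<dots> = exp (d \<theta> x)" by (simp flip: exp_add)
      finally have "q x * (exp ?h * (1 + (d \<theta> x - ?h))) \<le> q x * exp (d \<theta> x)"
        using q_pos[of x] by (intro mult_left_mono) auto
      then show "exp ?h * ((1 - ?h) * q x + q x * d \<theta> x) \<le> q x * exp (d \<theta> x)"
        by (simp add: algebra_simps)
    qed
    also have "\<dots> = Z \<theta> / Z \<theta>'" by (simp add: Gp Z_def)
    finally have "ln (exp ?h) \<le> ln (Z \<theta> / Z \<theta>')"
      using Z_pos by (subst ln_le_cancel_iff) auto
    then show ?thesis using Z_pos[of \<theta>] Z_pos[of \<theta>'] by (simp add: f ln_div)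
  qed
  have "GDERIV ?J \<theta>' :> ?P *v (\<theta>' - (\<theta>' + \<nu>)) + 0"
    by (subst ext[of ?J, OF J]) (use GDERIV_quadratic[OF P, of "\<theta>' + \<nu>" 0 _ \<theta>'] in simp)
  then have "GDERIV (\<lambda>\<theta>. ?J \<theta> - f \<theta>) \<theta>' :> ?P *v (\<theta>' - (\<theta>' + \<nu>)) - g"
    using f' by (intro GDERIV_diff) simp_all
  \<comment> \<open>By \<open>majorise\<close> the difference has a minimum at
    \<open>\<theta>'\<close>, so its derivative vanishes there; this determines
    \<open>\<nu>\<close>.\<close>
  then have "(\<lambda>h. h \<bullet> (?P *v (\<theta>' - (\<theta>' + \<nu>)) - g)) = (\<lambda>h. 0)"
    unfolding gderiv_def using majorise
    by (intro differential_zero_maxmin[of \<theta>' UNIV]) auto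
  then have "?P *v (\<theta>' - (\<theta>' + \<nu>)) - g = 0"
    by (metis inner_eq_zero_iff)
  then have "- (?P *v \<nu>) = g"
    using matrix_vector_mult_diff_distrib[of ?P 0 \<nu>] by simp
  then have "S *v g = - (S *v (?P *v \<nu>))"
    using matrix_vector_mult_diff_distrib[of S 0 "?P *v \<nu>"] by auto
  then have "\<nu> = - (S *v g)" by simp
  then have "\<theta>' + \<nu> = \<theta>' - S *v g" by simp
  from J[unfolded this] show ?thesis by (rule that)
qed

text \<open>The density \<open>G \<cdot> p \<theta>\<close> normalises to the normal density with covariance
  \<open>\<Sigma> - \<Sigma> Q \<Sigma>\<close> and mean \<open>\<theta> - \<Sigma> (Q \<theta> + b)\<close>, which prescribes \<open>G\<close> up to
  a constant factor.\<close>

lemma em_setting_mvn_density_quadratic: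
  fixes S Q :: "real^'n^'n" and b :: "real^'n"
  assumes S: "sym_pos_def S" and SQ: "sym_pos_def (matrix_inv S - Q)"
    and f: "f = (\<lambda>\<theta>. 1 / 2 * (\<theta> \<bullet> (Q *v \<theta>)) + b \<bullet> \<theta>)"
  shows "\<exists>G. em_setting (mvn_density S) G f"
proof -
  let ?p = "mvn_density S" and ?P = "matrix_inv S"
  note S_inv = matrix_inv_mult[OF sym_pos_def_invertible[OF S]]
  have tr_S: "transpose S = S" using S by (simp add: sym_pos_def_def)
  \<comment> \<open>Written as a congruence of \<open>?P - Q\<close> by \<open>S\<close>, the
    covariance inherits positive definiteness.\<close>
  define T where "T = S ** (?P - Q) ** S"
  have T_mult: "T *v v = S *v ((?P - Q) *v (S *v v))" for v
    by (simp add: T_def matrix_vector_mul_assoc matrix_mul_assoc)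
  have T: "sym_pos_def T"
    unfolding sym_pos_def_def
  proof (intro conjI allI impI)
    have "transpose (?P - Q) = ?P - Q" using SQ by (simp add: sym_pos_def_def)
    then show "transpose T = T"
      by (simp add: T_def matrix_transpose_mul tr_S matrix_mul_assoc)
    fix v :: "real^'n" assume "v \<noteq> 0"
    then have "S *v v \<noteq> 0" using S_inv(3)[of v] by force
    then have "0 < (S *v v) \<bullet> ((?P - Q) *v (S *v v))"
      using SQ unfolding sym_pos_def_def by blast
    then show "0 < v \<bullet> (T *v v)"
      by (simp add: T_mult symmetric_inner[OF tr_S])
  qed
  let ?g = "mvn_density T" and ?M = "matrix_inv T"
  define m where "m \<theta> = \<theta> - S *v (Q *v \<theta> + b)" for \<theta>
  \<comment> \<open>At parameter 0, where \<open>f\<close> is 0, the product of \<open>G\<close> and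
    the density is itself a normal density; this fixes the constant factor.\<close>
  define G where "G x = ?g (m 0) x / ?p 0 x" for x
  have p_pos: "?p \<theta> x > 0" and g_pos: "?g \<theta> x > 0" for \<theta> x
    using S T by (auto intro: mvn_density_pos)
  have G_pos: "G x > 0" for x by (simp add: G_def p_pos g_pos)
  have [measurable]: "G \<in> borel_measurable borel"
    unfolding G_def by measurable

  have Gp: "G x * ?p \<theta> x = exp (- f \<theta>) * ?g (m \<theta>) x" for \<theta> x
  proof -
    \<comment> \<open>Moving the mean of \<open>?g\<close> by \<open>u\<close> tilts it by the same
      linear function of \<open>x\<close> as moving the mean of \<open>?p\<close> by
      \<open>\<theta>\<close>. What remains is the constant \<open>- f \<theta>\<close>, and
      \<open>u\<close> equals \<open>m \<theta> - m 0\<close>.\<close>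
    define u where "u = T *v (?P *v \<theta>)"
    have Mu: "?M *v u = ?P *v \<theta>"
      by (simp add: u_def matrix_inv_mult[OF sym_pos_def_invertible[OF T]])
    have u: "u = \<theta> - S *v (Q *v \<theta>)"
      by (simp add: u_def T_mult S_inv matrix_vector_mult_diff_rdistrib matrix_vector_mult_diff_distrib)
    have m: "m \<theta> = m 0 + u" and m0: "m 0 = - (S *v b)"
      by (simp_all add: m_def u matrix_vector_right_distrib)
    have SP: "(S *v v) \<bullet> (?P *v w) = v \<bullet> w" for v w
      by (simp add: symmetric_inner[OF tr_S] S_inv)
    have uP: "u \<bullet> (?P *v \<theta>) = \<theta> \<bullet> (?P *v \<theta>) - \<theta> \<bullet> (Q *v \<theta>)"
      by (simp add: u inner_diff_left SP inner_commute[of "Q *v \<theta>"])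
    have "G x * ?p \<theta> x = ?g (m 0) x * exp (x \<bullet> (?P *v \<theta>) - \<theta> \<bullet> (?P *v \<theta>) / 2)"
      using mvn_density_shift[OF S, of 0 \<theta> x] p_pos[of 0 x] by (simp add: G_def)
    also have "x \<bullet> (?P *v \<theta>) - \<theta> \<bullet> (?P *v \<theta>) / 2 =
        - f \<theta> + ((x - m 0) \<bullet> (?M *v u) - u \<bullet> (?M *v u) / 2)"
      by (simp add: Mu m0 uP f inner_diff_left inner_add_left SP field_simps)
    also have "?g (m 0) x * exp \<dots> = exp (- f \<theta>) * ?g (m \<theta>) x"
      by (simp only: m mvn_density_shift[OF T] exp_add mult_ac)
    finally show ?thesis .
  qed

  have law_G: "has_bochner_integral (law ?p \<theta>) G (exp (- f \<theta>))" for \<theta>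
  proof (rule has_bochner_integral_law)
    have "has_bochner_integral lborel (\<lambda>x. exp (- f \<theta>) * ?g (m \<theta>) x) (exp (- f \<theta>) * 1)"
      by (intro has_bochner_integral_mult_right has_bochner_integral_mvn_density_1 T)
    then show "has_bochner_integral lborel (\<lambda>x. ?p \<theta> x *\<^sub>R G x) (exp (- f \<theta>))"
      using Gp[of _ \<theta>] by (simp add: mult.commute)
  qed (simp_all add: p_pos less_imp_le)
  have em_q: "em_q ?p G \<theta> x = ?g (m \<theta>) x" for \<theta> x
    using law_G[of \<theta>] by (simp add: em_q_def Gp has_bochner_integral_integral_eq)
  have "integrable lborel (\<lambda>x. em_q ?p G \<theta>' x * ln (G x * ?p \<theta> x))" for \<theta>' \<theta>
  proof -
    define c where "c = - f \<theta> - ln (sqrt ((2 * pi) ^ CARD('n) * det T))"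
    have "em_q ?p G \<theta>' x * ln (G x * ?p \<theta> x) = c * ?g (m \<theta>') x
        - 1 / 2 * (?g (m \<theta>') x * ((x - m \<theta>) \<bullet> (?M *v (x - m \<theta>))))" for x
    proof -
      have "ln (G x * ?p \<theta> x) = c - 1 / 2 * ((x - m \<theta>) \<bullet> (?M *v (x - m \<theta>)))"
        using g_pos[of "m \<theta>" x] by (simp add: Gp ln_mult ln_mvn_density[OF T] c_def)
      then show ?thesis
        by (simp add: em_q right_diff_distrib mult.commute)
    qed
    moreover have "integrable lborel (?g (m \<theta>'))"
      using has_bochner_integral_mvn_density_1[OF T] by (rule integrable.intros)
    ultimately show ?thesis
      by (simp only:) (intro Bochner_Integration.integrable_diff integrable_mult_right
        integrable_mvn_density_quadratic[OF T]; simp)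
  qed
  then have "em_setting ?p G f"
    using law_G by (simp add: em_setting_def G_pos has_bochner_integral_iff)
  then show ?thesis by blast
qed

text \<open>Existence of an admissible \<open>G\<close> keeps the quantified claim from being
  vacuous, and invertibility of the Fisher information gives \<open>matrix_inv\<close> its
  meaning.\<close>

theorem corollary4p2:
  fixes Q \<Sigma> :: "real^'p^'p" and b :: "real^'p"
    and f :: "real^'p \<Rightarrow> real" and p :: "real^'p \<Rightarrow> real^'p \<Rightarrow> real"
  assumes Q: "sym_pos_semidef Q"
    and \<Sigma>: "sym_pos_def \<Sigma>"
    and \<Sigma>Q: "sym_pos_def (matrix_inv \<Sigma> - Q)"
    and f: "f = (\<lambda>\<theta>. 1 / 2 * (\<theta> \<bullet> (Q *v \<theta>)) + b \<bullet> \<theta>)"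
    and p: "p = mvn_density \<Sigma>"
  shows "(\<exists>G. em_setting p G f) \<and>
    (\<forall>G. em_setting p G f \<longrightarrow>
       (\<forall>\<theta>' \<theta>.
          (em_step p G \<theta>' \<theta> \<longleftrightarrow> \<theta> = natural_gradient_step p f \<theta>') \<and>
          (GDERIV (em_objective p G \<theta>') \<theta> :> 0 \<longleftrightarrow> \<theta> = natural_gradient_step p f \<theta>'))) \<and>
    (\<forall>\<theta>. invertible (fisher_information p \<theta>) \<and>
       natural_gradient_step p f \<theta> = \<theta> - \<Sigma> *v (Q *v \<theta> + b))"
proof -
  let ?P = "matrix_inv \<Sigma>"
  have spd_P: "sym_pos_def ?P" using \<Sigma> by (rule sym_pos_def_matrix_inv)
  then have P: "transpose ?P = ?P" by (simp add: sym_pos_def_def)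
  note \<Sigma>_inv = matrix_inv_mult[OF sym_pos_def_invertible[OF \<Sigma>]]
  note P_inv = matrix_inv_mult[OF sym_pos_def_invertible[OF spd_P]]
  have fisher: "fisher_information p \<theta> = ?P" for \<theta>
    using fisher_information_mvn_density[OF \<Sigma>] by (simp add: p)
  have "transpose Q = Q" using Q by (simp add: sym_pos_semidef_def)
  then have f': "GDERIV f \<theta> :> Q *v \<theta> + b" for \<theta>
    using GDERIV_quadratic[of Q 0 b 0 \<theta>] by (simp add: f)
  have "matrix_inv ?P *v v = \<Sigma> *v v" for v
    by (metis P_inv(3) \<Sigma>_inv(3))
  then have step: "natural_gradient_step p f \<theta> = \<theta> - \<Sigma> *v (Q *v \<theta> + b)" for \<theta>
    by (simp add: natural_gradient_step_def fisher gradient_eq[OF f'])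
  have "(em_step p G \<theta>' \<theta> \<longleftrightarrow> \<theta> = natural_gradient_step p f \<theta>') \<and>
      (GDERIV (em_objective p G \<theta>') \<theta> :> 0 \<longleftrightarrow> \<theta> = natural_gradient_step p f \<theta>')"
    if em: "em_setting p G f" for G \<theta>' \<theta>
  proof -
    define \<mu> where "\<mu> = natural_gradient_step p f \<theta>'"
    obtain K where K: "\<And>\<eta>. em_objective p G \<theta>' \<eta> = (\<eta> - (\<theta>' - \<Sigma> *v (Q *v \<theta>' + b))) \<bullet>
        (?P *v (\<eta> - (\<theta>' - \<Sigma> *v (Q *v \<theta>' + b)))) / 2 + K"
      using em_objective_mvn_density[OF \<Sigma> em[unfolded p] f'[of \<theta>']] unfolding p by blast
    have J: "em_objective p G \<theta>' = (\<lambda>\<eta>. (\<eta> - \<mu>) \<bullet> (?P *v (\<eta> - \<mu>)) / 2 + 0 \<bullet> \<eta> + K)"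
      by (simp add: fun_eq_iff K \<mu>_def step)
    \<comment> \<open>Strict positivity away from \<open>\<mu>\<close> makes the minimiser
      unique.\<close>
    have pos: "(\<eta> - \<mu>) \<bullet> (?P *v (\<eta> - \<mu>)) > 0" if "\<eta> \<noteq> \<mu>" for \<eta>
      using spd_P that by (simp add: sym_pos_def_def)
    have "em_step p G \<theta>' \<theta> \<longleftrightarrow> \<theta> = \<mu>"
    proof
      assume "em_step p G \<theta>' \<theta>"
      then have "em_objective p G \<theta>' \<theta> \<le> em_objective p G \<theta>' \<mu>"
        by (auto simp: em_step_def is_arg_min_def not_less)
      then show "\<theta> = \<mu>" using pos[of \<theta>] by (force simp: J)
    next
      assume "\<theta> = \<mu>"
      moreover have "\<not> (\<eta> - \<mu>) \<bullet> (?P *v (\<eta> - \<mu>)) < 0" for \<eta>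
        using pos[of \<eta>] by (cases "\<eta> = \<mu>") auto
      ultimately show "em_step p G \<theta>' \<theta>"
        by (simp add: em_step_def is_arg_min_def J)
    qed
    moreover have "GDERIV (em_objective p G \<theta>') \<theta> :> 0 \<longleftrightarrow> \<theta> = \<mu>"
    proof -
      have der: "GDERIV (em_objective p G \<theta>') \<theta> :> ?P *v (\<theta> - \<mu>)"
        unfolding J using GDERIV_quadratic[OF P, of \<mu> 0 K \<theta>] by simp
      have "?P *v (\<theta> - \<mu>) = 0 \<longleftrightarrow> \<theta> = \<mu>"
        using \<Sigma>_inv(4)[of "\<theta> - \<mu>"] by auto
      then show ?thesis using der gradient_eq by metis
    qed
    ultimately show ?thesis by (simp add: \<mu>_def)
  qed
  moreover have "\<exists>G. em_setting p G f"
    unfolding p using \<Sigma> \<Sigma>Q f by (rule em_setting_mvn_density_quadratic)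
  ultimately show ?thesis
    using step sym_pos_def_invertible[OF spd_P] by (simp add: fisher)
qed

end
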